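(* Let $S=\langle n_0,\ldots,n_p\rangle$ be a numerical semigroup on a compound sequence (NSCS), with associated integers $a_1,\ldots,a_p,b_1,\ldots,b_p$. Set $N=\{b_1-a_1,b_2-a_2,\ldots,b_p-a_p\}$. 1. If $|N|=1$, then $\Delta(S)=N$. 2. If $|N|>1$ and $N=\{\alpha,2\alpha,\ldots,|N|\alpha\}$ for some $\alpha\in\mathbb{N}$, then $\Delta(S)=N$. 3. If $|N|>1$ and $N=\{2\alpha,3\alpha,\ldots,(|N|+1)\alpha\}$ for some $\alpha\in\mathbb{N}$, then $\Delta(S)=N\cup\{\alpha\}$.
   Context: Let $\mathbb{N}$ be the positive integers and $\mathbb{N}_0$ the nonnegative integers. A compound sequence is a sequence $\{n_0,\ldots,n_p\}$ with $n_i=b_1b_2\cdots b_i\,a_{i+1}a_{i+2}\cdots a_p$ for $i\in[0,p]$, where $p,a_1,\ldots,a_p,b_1,\ldots,b_p\in\mathbb{N}$ satisfy $2\le a_i<b_i$ for all $i\in[1,p]$ and $\gcd(a_i,b_j)=1$ for all $i,j\in[1,p]$ with $i\ge j$. An NSCS is a numerical semigroup $S=\langle n_0,\ldots,n_p\rangle$ whose minimal generators form a compound sequence. The factorization homomorphism is $\phi:\mathbb{N}_0^{p+1}\to S$, $\phi(x_0,\ldots,x_p)=x_0n_0+\cdots+x_pn_p$; the elements of $\phi^{-1}(n)$ are the factorizations of $n$. The length of $x\in\mathbb{N}_0^{p+1}$ is $|x|=x_0+\cdots+x_p$. The length set of $n\in S$ is $\mathcal{L}(n)=\{|x|:x\in\phi^{-1}(n)\}=\{s_1<s_2<\cdots<s_k\}$,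 its delta set is $\Delta(n)=\{s_i-s_{i-1}:i\in[2,k]\}$ (empty if $|\mathcal{L}(n)|=1$), and $\Delta(S)=\bigcup_{n\in S}\Delta(n)$. *)

theory Defs
  imports "HOL-Library.FuncSet"
begin

definition numerical_semigroup :: "nat set \<Rightarrow> bool" where
  "numerical_semigroup S \<longleftrightarrow>
     0 \<in> S \<and> (\<forall>x\<in>S. \<forall>y\<in>S. x + y \<in> S) \<and> finite (UNIV - S)"

inductive_set submonoid_generated :: "nat set \<Rightarrow> nat set" for G where
  zero: "0 \<in> submonoid_generated G"
| add: "g \<in> G \<Longrightarrow> x \<in> submonoid_generated G \<Longrightarrow> g + x \<in> submonoid_generated G"

definition minimal_generating_set :: "nat set \<Rightarrow> nat set \<Rightarrow> bool" where
  "minimal_generating_set G S \<longleftrightarrow>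
     submonoid_generated G = S \<and> (\<forall>H. H \<subset> G \<longrightarrow> submonoid_generated H \<noteq> S)"

text \<open>The parameters are \<open>a\<close> and \<open>b\<close> restricted to \<open>{1..p}\<close>; values outside are irrelevant.\<close>

definition compound_parameters :: "nat \<Rightarrow> (nat \<Rightarrow> nat) \<Rightarrow> (nat \<Rightarrow> nat) \<Rightarrow> bool" where
  "compound_parameters p a b \<longleftrightarrow>
     p \<ge> 1 \<and>
     (\<forall>i\<in>{1..p}. 2 \<le> a i \<and> a i < b i) \<and>
     (\<forall>i\<in>{1..p}. \<forall>j\<in>{1..p}. i \<ge> j \<longrightarrow> gcd (a i) (b j) = 1)"

definition compound_seq :: "nat \<Rightarrow> (nat \<Rightarrow> nat) \<Rightarrow> (nat \<Rightarrow> nat) \<Rightarrow> nat \<Rightarrow> nat" where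
  "compound_seq p a b i = (\<Prod>j\<in>{1..i}. b j) * (\<Prod>j\<in>{i+1..p}. a j)"

definition NSCS :: "nat \<Rightarrow> (nat \<Rightarrow> nat) \<Rightarrow> (nat \<Rightarrow> nat) \<Rightarrow> nat set \<Rightarrow> bool" where
  "NSCS p a b S \<longleftrightarrow>
     compound_parameters p a b \<and>
     numerical_semigroup S \<and>
     minimal_generating_set (compound_seq p a b ` {0..p}) S"

text \<open>
  In the following, \<open>g 0, \<dots>, g p\<close> are the generators, and \<open>\<nat>\<^sub>0\<^bsup>p+1\<^esup>\<close> is represented by
  \<open>{0..p} \<rightarrow>\<^sub>E UNIV\<close>, so that a factorization is determined by its \<open>p + 1\<close> coordinates.
\<close>

definition factorization_hom :: "nat \<Rightarrow> (nat \<Rightarrow> nat) \<Rightarrow> (nat \<Rightarrow> nat) \<Rightarrow> nat" where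
  "factorization_hom p g x = (\<Sum>i\<in>{0..p}. x i * g i)"

definition factorizations :: "nat \<Rightarrow> (nat \<Rightarrow> nat) \<Rightarrow> nat \<Rightarrow> (nat \<Rightarrow> nat) set" where
  "factorizations p g n = {x \<in> {0..p} \<rightarrow>\<^sub>E UNIV. factorization_hom p g x = n}"

definition factorization_length :: "nat \<Rightarrow> (nat \<Rightarrow> nat) \<Rightarrow> nat" where
  "factorization_length p x = (\<Sum>i\<in>{0..p}. x i)"

definition length_set :: "nat \<Rightarrow> (nat \<Rightarrow> nat) \<Rightarrow> nat \<Rightarrow> nat set" where
  "length_set p g n = factorization_length p ` factorizations p g n"

text \<open>
  Length sets are finite when all generators are positive, so \<open>sorted_list_of_set\<close> lists
  \<open>s\<^sub>1 < \<dots> < s\<^sub>k\<close>, here indexed from \<open>0\<close>.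
\<close>

definition delta_elem :: "nat \<Rightarrow> (nat \<Rightarrow> nat) \<Rightarrow> nat \<Rightarrow> nat set" where
  "delta_elem p g n =
     (let s = sorted_list_of_set (length_set p g n)
      in {s ! i - s ! (i - 1) | i. 1 \<le> i \<and> i < length s})"

definition delta_set :: "nat \<Rightarrow> (nat \<Rightarrow> nat) \<Rightarrow> nat set \<Rightarrow> nat set" where
  "delta_set p g S = (\<Union>n\<in>S. delta_elem p g n)"

end

theory Submission
  imports Defs
begin

text \<open>
  Since \<open>b\<^sub>i n\<^sub>i\<^sub>-\<^sub>1 = a\<^sub>i n\<^sub>i\<close>, one may trade \<open>a\<^sub>i\<close> copies of \<open>n\<^sub>i\<close> for \<open>b\<^sub>i\<close> copies of \<open>n\<^sub>i\<^sub>-\<^sub>1\<close>,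
  which lengthens a factorization by \<open>b\<^sub>i - a\<^sub>i\<close>. A factorization admitting no such trade has
  \<open>x\<^sub>i < a\<^sub>i\<close> for all \<open>i \<ge> 1\<close>, and by coprimality each element has only one of these. So every
  factorization climbs by trades to the same longest one; consequently the gaps are multiples of
  \<open>gcd N\<close> bounded by \<open>Max N\<close>. Conversely, a factorization of \<open>a\<^sub>i n\<^sub>i\<close> uses only generators of
  index below \<open>i\<close> (and then has length at least \<open>b\<^sub>i\<close>) or only those of index at least \<open>i\<close> (length
  at most \<open>a\<^sub>i\<close>), which realises \<open>b\<^sub>i - a\<^sub>i\<close>. In the third case \<open>\<alpha>\<close> is realised by
  \<open>a\<^sub>i n\<^sub>i + a\<^sub>j n\<^sub>j\<close> with \<open>b\<^sub>i - a\<^sub>i = 2 \<alpha>\<close> and \<open>b\<^sub>j - a\<^sub>j = 3 \<alpha>\<close>.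
\<close>

section \<open>Gaps of a finite set of naturals\<close>

text \<open>Trades positions in the sorted list for the order alone: consecutive entries are two
  elements with nothing of the set strictly between them. Delta sets are handled only in this form
  afterwards.\<close>

lemma consecutive_differences_iff:
  fixes L :: "nat set"
  assumes "finite L"
  shows "d \<in> {sorted_list_of_set L ! i - sorted_list_of_set L ! (i - 1) | i.
             1 \<le> i \<and> i < length (sorted_list_of_set L)}
    \<longleftrightarrow> d > 0 \<and> (\<exists>s\<in>L. s + d \<in> L \<and> (\<forall>t\<in>L. t \<le> s \<or> s + d \<le> t))"
    (is "d \<in> ?D \<longleftrightarrow> ?R")
proof -
  define l where "l = sorted_list_of_set L"
  have set_l: "set l = L" and mono: "sorted_wrt (<) l"
    using assms by (simp_all add: l_def)
  have lt: "l ! i < l ! j" if "i < j" "j < length l" for i j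
    using mono that by (simp add: sorted_wrt_iff_nth_less)
  have le: "l ! i \<le> l ! j" if "i \<le> j" "j < length l" for i j
    using lt[of i j] that by (cases "i = j") auto
  show ?thesis
  proof
    assume "d \<in> ?D"
    then obtain i where i: "d = l ! i - l ! (i - 1)" "1 \<le> i" "i < length l"
      by (auto simp: l_def)
    have less: "l ! (i - 1) < l ! i"
      using lt i by simp
    have "\<forall>t\<in>L. t \<le> l ! (i - 1) \<or> l ! i \<le> t"
    proof
      fix t assume "t \<in> L"
      then obtain k where "k < length l" "t = l ! k"
        using set_l by (metis in_set_conv_nth)
      then show "t \<le> l ! (i - 1) \<or> l ! i \<le> t"
        using le[of k "i - 1"] le[of i k] i by (cases "k < i") auto
    qed
    moreover have "l ! (i - 1) \<in> L" "l ! i \<in> L"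
      using i set_l nth_mem[of "i - 1" l] nth_mem[of i l] by auto
    ultimately show ?R
      using i less by (intro conjI bexI[of _ "l ! (i - 1)"]) auto
  next
    assume ?R
    then obtain s where s: "d > 0" "s \<in> L" "s + d \<in> L" "\<forall>t\<in>L. t \<le> s \<or> s + d \<le> t"
      by blast
    obtain j k where jk: "j < length l" "l ! j = s" "k < length l" "l ! k = s + d"
      using s set_l by (metis in_set_conv_nth)
    have "j < k"
      using le[of k j] jk s(1) by (cases "j < k") auto
    moreover have "\<not> j < k - 1"
    proof
      assume "j < k - 1"
      then have "s < l ! (k - 1)" "l ! (k - 1) < s + d" "l ! (k - 1) \<in> L"
        using lt[of j "k - 1"] lt[of "k - 1" k] jk set_l nth_mem[of "k - 1" l] by auto
      then show False
        using s(4) by force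
    qed
    ultimately have "j = k - 1" "1 \<le> k"
      by auto
    then have "d = l ! k - l ! (k - 1)"
      using jk by simp
    then show "d \<in> ?D"
      using jk \<open>1 \<le> k\<close> unfolding l_def by blast
  qed
qed

section \<open>Length sets over arbitrary generators\<close>

lemma length_le_of_factorization:
  assumes "\<And>i. i \<in> {0..p} \<Longrightarrow> 1 \<le> g i" and "x \<in> factorizations p g m"
  shows "factorization_length p x \<le> m"
proof -
  have "(\<Sum>i\<in>{0..p}. x i) \<le> (\<Sum>i\<in>{0..p}. x i * g i)"
    by (rule sum_mono) (use assms(1) in force)
  then show ?thesis
    using assms(2) by (simp add: factorizations_def factorization_hom_def factorization_length_def)
qed

lemma finite_length_set:
  assumes "\<And>i. i \<in> {0..p} \<Longrightarrow> 1 \<le> g i"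
  shows "finite (length_set p g m)"
  by (rule finite_subset[of _ "{..m}"])
    (use length_le_of_factorization[of p g] assms in \<open>auto simp: length_set_def\<close>)

text \<open>Factorizations add coordinatewise; \<open>restrict\<close> brings the sum back into the
  extensional function space.\<close>

lemma length_set_add:
  assumes "s \<in> length_set p g m" and "t \<in> length_set p g n"
  shows "s + t \<in> length_set p g (m + n)"
proof -
  obtain x y where xy: "x \<in> factorizations p g m" "s = factorization_length p x"
    "y \<in> factorizations p g n" "t = factorization_length p y"
    using assms by (auto simp: length_set_def)
  let ?z = "restrict (\<lambda>i. x i + y i) {0..p}"
  have "?z \<in> factorizations p g (m + n)"
    using xy by (auto simp: factorizations_def factorization_hom_def algebra_simps sum.distrib)
  moreover have "factorization_length p ?z = s + t"
    using xy by (simp add: factorization_length_def sum.distrib)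
  ultimately show ?thesis
    unfolding length_set_def by (metis imageI)
qed

lemma length_set_multiple:
  assumes "i \<in> {0..p}"
  shows "c \<in> length_set p g (c * g i)"
proof -
  let ?z = "restrict (\<lambda>j. if j = i then c else 0) {0..p}"
  have "?z \<in> factorizations p g (c * g i)"
    using assms by (simp add: factorizations_def factorization_hom_def if_distrib[of "\<lambda>u. u * _"]
        sum.delta' cong: if_cong)
  moreover have "factorization_length p ?z = c"
    using assms by (simp add: factorization_length_def)
  ultimately show ?thesis
    unfolding length_set_def by (metis imageI)
qed

section \<open>Arithmetic of compound sequences\<close>

locale compound =
  fixes p :: nat and a b :: "nat \<Rightarrow> nat"
  assumes params: "compound_parameters p a b"
begin

abbreviation n :: "nat \<Rightarrow> nat" where
  "n \<equiv> compound_seq p a b"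

lemma a_ge_2: "i \<in> {1..p} \<Longrightarrow> 2 \<le> a i"
  and a_less_b: "i \<in> {1..p} \<Longrightarrow> a i < b i"
  and coprime_a_b: "i \<in> {1..p} \<Longrightarrow> j \<in> {1..p} \<Longrightarrow> j \<le> i \<Longrightarrow> coprime (a i) (b j)"
  using params by (auto simp: compound_parameters_def coprime_iff_gcd_eq_1)

lemma n_pos: "i \<in> {0..p} \<Longrightarrow> 1 \<le> n i"
proof -
  assume "i \<in> {0..p}"
  then have "0 < b j" if "j \<in> {1..i}" for j
    using a_less_b[of j] that by auto
  moreover have "0 < a j" if "j \<in> {i + 1..p}" for j
    using a_ge_2[of j] that by auto
  ultimately have "0 < n i"
    unfolding compound_seq_def by (intro mult_pos_pos prod_pos)
  then show ?thesis
    by simp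
qed

text \<open>Passing from \<open>n (i - 1)\<close> to \<open>n i\<close> replaces the single factor
  \<open>a i\<close> by \<open>b i\<close>.\<close>

lemma n_trade:
  assumes "i \<in> {1..p}"
  shows "n i * a i = n (i - 1) * b i"
proof -
  obtain k where k: "i = Suc k"
    using assms by (cases i) auto
  have "{i..p} = insert i {i + 1..p}"
    using assms by auto
  moreover have "{1..i} = insert i {1..k}"
    using k by auto
  ultimately show ?thesis
    using k by (simp add: compound_seq_def algebra_simps)
qed

lemma n_mono:
  assumes "i \<le> j" and "j \<le> p"
  shows "n i \<le> n j"
  using assms
proof (induction j rule: dec_induct)
  case (step j)
  have "n j * a (Suc j) \<le> n j * b (Suc j)"
    using a_less_b[of "Suc j"] step by simp
  also have "\<dots> = n (Suc j) * a (Suc j)"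
    using n_trade[of "Suc j"] step by simp
  finally have "n j \<le> n (Suc j)"
    using a_ge_2[of "Suc j"] step by simp
  then show ?case
    using step by simp
qed simp

text \<open>The factors \<open>a (j + 1)\<close>, ..., \<open>a p\<close> of \<open>n j\<close>
  include all those from index \<open>k\<close> on.\<close>

lemma prod_a_dvd_n:
  assumes "j < k"
  shows "(\<Prod>i\<in>{k..p}. a i) dvd n j"
  unfolding compound_seq_def
  by (rule dvd_mult, rule prod_dvd_prod_subset) (use assms in auto)

lemma prod_b_dvd_n:
  assumes "k \<le> j"
  shows "(\<Prod>i\<in>{1..k}. b i) dvd n j"
  unfolding compound_seq_def
  by (rule dvd_mult2, rule prod_dvd_prod_subset) (use assms in auto)

lemma coprime_a_prod_b:
  assumes "k \<in> {1..p}" and "k \<le> i" and "i \<le> p"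
  shows "coprime (a i) (\<Prod>j\<in>{1..k}. b j)"
  by (rule prod_coprime_right) (use assms coprime_a_b in auto)

section \<open>Trades and reduced factorizations\<close>

lemma trade_factorization:
  assumes x: "x \<in> factorizations p n m" and i: "i \<in> {1..p}" and ge: "a i \<le> x i"
  obtains y where "y \<in> factorizations p n m"
    and "factorization_length p y = factorization_length p x + (b i - a i)"
proof
  let ?y = "x(i := x i - a i, i - 1 := x (i - 1) + b i)"
  have split: "sum f {0..p} = f i + f (i - 1) + sum f ({0..p} - {i} - {i - 1})" for f :: "nat \<Rightarrow> nat"
  proof -
    have "i \<in> {0..p}" "i - 1 \<in> {0..p} - {i}"
      using i by auto
    then show ?thesis
      using sum.remove[of "{0..p}" i f] sum.remove[of "{0..p} - {i}" "i - 1" f] by simp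
  qed
  have rest: "(\<Sum>j\<in>{0..p} - {i} - {i - 1}. f (?y j) j) = (\<Sum>j\<in>{0..p} - {i} - {i - 1}. f (x j) j)"
    for f :: "nat \<Rightarrow> nat \<Rightarrow> nat"
    by (rule sum.cong) auto
  \<comment> \<open>Uses \<open>i \<ge> 1\<close>, since truncated subtraction gives
    \<open>0 - 1 = 0\<close>.\<close>
  have ne: "i - 1 \<noteq> i"
    using i by auto
  have "(x i - a i) * n i + (x (i - 1) + b i) * n (i - 1) = x i * n i + x (i - 1) * n (i - 1)"
    using n_trade[OF i] ge mult_le_mono1[OF ge, of "n i"]
    by (simp add: algebra_simps diff_mult_distrib)
  then have "factorization_hom p n ?y = factorization_hom p n x"
    unfolding factorization_hom_def
    using split[of "\<lambda>j. ?y j * n j"] split[of "\<lambda>j. x j * n j"] rest[of "\<lambda>u j. u * n j"] ne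
    by simp
  then show "?y \<in> factorizations p n m"
    using x i by (auto simp: factorizations_def PiE_iff extensional_def)
  show "factorization_length p ?y = factorization_length p x + (b i - a i)"
    unfolding factorization_length_def
    using split[of ?y] split[of x] rest[of "\<lambda>u j. u"] ne ge a_less_b[OF i]
    by (simp, linarith)
qed

text \<open>No trade is possible. Coordinate 0 is unbounded because \<open>n 0\<close> has no
  generator below it to be traded for.\<close>

definition reduced :: "(nat \<Rightarrow> nat) \<Rightarrow> bool" where
  "reduced x \<longleftrightarrow> (\<forall>i\<in>{1..p}. x i < a i)"

text \<open>Let \<open>k\<close> be the largest index at which \<open>x\<close> and \<open>y\<close>
  differ. The product of \<open>a k\<close>, ..., \<open>a p\<close> divides every generator below
  \<open>k\<close>, hence also \<open>(x k - y k) * n k\<close>. Cancelling the factors of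
  \<open>n k\<close> leaves \<open>a k\<close> dividing \<open>x k - y k\<close>, a nonzero
  difference of two numbers below \<open>a k\<close>.\<close>

lemma reduced_factorization_unique:
  assumes x: "x \<in> factorizations p n m" "reduced x"
    and y: "y \<in> factorizations p n m" "reduced y"
  shows "x = y"
proof (rule ccontr)
  assume "x \<noteq> y"
  let ?D = "{i. i \<le> p \<and> x i \<noteq> y i}"
  define k where "k = Max ?D"
  have "?D \<noteq> {}"
    using \<open>x \<noteq> y\<close> x y PiE_ext[of x "{0..p}" "\<lambda>_. UNIV" y] by (auto simp: factorizations_def)
  then have k: "k \<le> p" "x k \<noteq> y k" and above: "\<And>i. k < i \<Longrightarrow> i \<le> p \<Longrightarrow> x i = y i"
    using Max_in[of ?D] Max_ge[of ?D] unfolding k_def by (fastforce simp: not_less)+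
  have split: "(\<Sum>i\<in>{0..p}. f i) = (\<Sum>i\<in>{..<k}. f i) + f k + (\<Sum>i\<in>{k<..p}. f i)"
    for f :: "nat \<Rightarrow> int"
  proof -
    have "{0..p} = insert k ({..<k} \<union> {k<..p})"
      using k by auto
    then show ?thesis
      by (simp add: sum.union_disjoint disjoint_iff)
  qed
  \<comment> \<open>The difference of the two factorizations may have negative entries, hence the
    passage to integers.\<close>
  have "int (\<Sum>i\<in>{0..p}. x i * n i) = int (\<Sum>i\<in>{0..p}. y i * n i)"
    using x y by (simp add: factorizations_def factorization_hom_def del: of_nat_sum)
  then have "(\<Sum>i\<in>{0..p}. int (x i) * int (n i)) = (\<Sum>i\<in>{0..p}. int (y i) * int (n i))"
    unfolding of_nat_sum of_nat_mult .
  then have "(\<Sum>i\<in>{0..p}. (int (x i) - int (y i)) * int (n i)) = 0"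
    by (simp add: left_diff_distrib sum_subtractf)
  moreover have "(\<Sum>i\<in>{k<..p}. (int (x i) - int (y i)) * int (n i)) = 0"
    by (rule sum.neutral) (use above in auto)
  ultimately have eq:
    "(int (x k) - int (y k)) * int (n k) = - (\<Sum>i\<in>{..<k}. (int (x i) - int (y i)) * int (n i))"
    using split[of "\<lambda>i. (int (x i) - int (y i)) * int (n i)"] by simp
  show False
  \<comment> \<open>Reducedness says nothing about coordinate 0; there the equation reads
    \<open>(x 0 - y 0) * n 0 = 0\<close>.\<close>
  proof (cases "k = 0")
    case True
    then show False
      using eq k n_pos[of 0] by simp
  next
    case False
    then have kp: "k \<in> {1..p}"
      using k by simp
    define A where "A = (\<Prod>i\<in>{k + 1..p}. a i)"
    define B where "B = (\<Prod>i\<in>{1..k}. b i)"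
    have "A > 0"
      unfolding A_def
    proof (intro prod_pos)
      fix i assume "i \<in> {k + 1..p}"
      then show "0 < a i"
        using a_ge_2[of i] by simp
    qed
    have "(\<Prod>i\<in>{k..p}. a i) = a k * A"
      unfolding A_def using k by (simp add: prod.atLeast_Suc_atMost)
    then have "a k * A dvd n i" if "i < k" for i
      using prod_a_dvd_n[OF that] by simp
    then have "int (a k * A) dvd (\<Sum>i\<in>{..<k}. (int (x i) - int (y i)) * int (n i))"
      by (intro dvd_sum dvd_mult) (metis int_dvd_int_iff lessThan_iff)
    \<comment> \<open>Here \<open>n k = B * A\<close>; \<open>A\<close> cancels, and
      \<open>B\<close> is coprime to \<open>a k\<close>.\<close>
    then have "int (a k) * int A dvd (int (x k) - int (y k)) * int B * int A"
      using eq by (simp add: compound_seq_def A_def B_def mult.assoc del: of_nat_prod)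
    then have "int (a k) dvd (int (x k) - int (y k)) * int B"
      using \<open>A > 0\<close> by simp
    moreover have "coprime (int (a k)) (int B)"
      using coprime_a_prod_b[OF kp, of k] k unfolding B_def coprime_int_iff by simp
    ultimately have "int (a k) dvd int (x k) - int (y k)"
      by (simp add: coprime_dvd_mult_left_iff)
    moreover have "\<bar>int (x k) - int (y k)\<bar> < int (a k)"
      using x(2)[unfolded reduced_def, rule_format, OF kp]
        y(2)[unfolded reduced_def, rule_format, OF kp] by linarith
    ultimately show False
      using k(2) zdvd_imp_le[of "int (a k)" "\<bar>int (x k) - int (y k)\<bar>"] by auto
  qed
qed

text \<open>Each trade lengthens the factorization by some \<open>b i - a i\<close>, a positive
  multiple of \<open>g\<close>, and lengths never exceed \<open>m\<close>, so trading must stop. The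
  inequality between the lengths keeps the truncated difference meaningful.\<close>

lemma exists_reduced_factorization:
  assumes "x \<in> factorizations p n m" and "\<And>i. i \<in> {1..p} \<Longrightarrow> g dvd b i - a i"
  shows "\<exists>y\<in>factorizations p n m. reduced y \<and> factorization_length p x \<le> factorization_length p y
    \<and> g dvd factorization_length p y - factorization_length p x"
  using assms(1)
proof (induction "m - factorization_length p x" arbitrary: x rule: less_induct)
  case less
  show ?case
  proof (cases "reduced x")
    case True
    then show ?thesis
      using less.prems by force
  next
    case False
    then obtain i where i: "i \<in> {1..p}" "a i \<le> x i"
      by (auto simp: reduced_def not_less)
    obtain y where y: "y \<in> factorizations p n m"
      "factorization_length p y = factorization_length p x + (b i - a i)"
      using trade_factorization[OF less.prems i] .
    have "m - factorization_length p y < m - factorization_length p x"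
      using y a_less_b[OF i(1)] length_le_of_factorization[OF n_pos y(1)] by simp
    from less.hyps[OF this y(1)] obtain z where z: "z \<in> factorizations p n m" "reduced z"
      "factorization_length p y \<le> factorization_length p z"
      "g dvd factorization_length p z - factorization_length p y"
      by blast
    have "factorization_length p z - factorization_length p x
        = (factorization_length p z - factorization_length p y) + (b i - a i)"
      using z y by simp
    then have "g dvd factorization_length p z - factorization_length p x"
      using z(4) assms(2)[OF i(1)] by (metis dvd_add)
    then show ?thesis
      using z y by force
  qed
qed

section \<open>Divisibility and upper bound for gaps\<close>

text \<open>Both lengths differ by a multiple of \<open>g\<close> from the length of the one reduced
  factorization, which cancels in \<open>t - s\<close>. For \<open>t < s\<close> the truncated
  difference is 0.\<close>

lemma dvd_length_diff:
  assumes "\<And>i. i \<in> {1..p} \<Longrightarrow> g dvd b i - a i"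
    and "s \<in> length_set p n m" and "t \<in> length_set p n m"
  shows "g dvd t - s"
proof -
  obtain x y where xy: "x \<in> factorizations p n m" "s = factorization_length p x"
    "y \<in> factorizations p n m" "t = factorization_length p y"
    using assms by (auto simp: length_set_def)
  obtain x' y' where "x' \<in> factorizations p n m" "reduced x'" "s \<le> factorization_length p x'"
    "g dvd factorization_length p x' - s"
    and "y' \<in> factorizations p n m" "reduced y'" "t \<le> factorization_length p y'"
    "g dvd factorization_length p y' - t"
    using exists_reduced_factorization[OF xy(1) assms(1)]
      exists_reduced_factorization[OF xy(3) assms(1)] xy(2,4) by blast
  moreover from this have "x' = y'"
    using reduced_factorization_unique by blast
  ultimately have "g dvd (factorization_length p x' - s) - (factorization_length p x' - t)"
    by (metis dvd_diff_nat)
  then show ?thesis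
    using \<open>t \<le> factorization_length p y'\<close> \<open>s \<le> factorization_length p x'\<close> \<open>x' = y'\<close>
    by (cases "s \<le> t") auto
qed

text \<open>A factorization that is not reduced admits a trade. A reduced one is longest, because
  every factorization climbs to it by trades.\<close>

lemma trade_or_longest:
  assumes "s \<in> length_set p n m"
  obtains i where "i \<in> {1..p}" "s + (b i - a i) \<in> length_set p n m"
  | "\<And>t. t \<in> length_set p n m \<Longrightarrow> t \<le> s"
proof -
  obtain x where x: "x \<in> factorizations p n m" "s = factorization_length p x"
    using assms by (auto simp: length_set_def)
  show thesis
  proof (cases "reduced x")
    case True
    have "t \<le> s" if t: "t \<in> length_set p n m" for t
    proof -
      obtain y where "y \<in> factorizations p n m" "t = factorization_length p y"
        using t by (auto simp: length_set_def)
      \<comment> \<open>With divisor 1 only the comparison of lengths remains.\<close>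
      then show ?thesis
        using exists_reduced_factorization[of y m 1] reduced_factorization_unique[OF x(1) True] x(2)
        by auto
    qed
    then show thesis
      using that(2) by blast
  next
    case False
    then obtain i where i: "i \<in> {1..p}" "a i \<le> x i"
      by (auto simp: reduced_def not_less)
    show thesis
      using trade_factorization[OF x(1) i] that(1)[OF i(1)] x(2)
      unfolding length_set_def by (metis imageI)
  qed
qed

lemma in_delta_elem_iff:
  "d \<in> delta_elem p n m \<longleftrightarrow> d > 0 \<and>
     (\<exists>s\<in>length_set p n m. s + d \<in> length_set p n m \<and> (\<forall>t\<in>length_set p n m. t \<le> s \<or> s + d \<le> t))"
  unfolding delta_elem_def Let_def
  by (rule consecutive_differences_iff) (rule finite_length_set, rule n_pos)

text \<open>For the upper bound: the lower end \<open>s\<close> of a gap is not the longest length,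
  so a trade leads from it to \<open>s + (b i - a i)\<close>, which cannot fall inside the
  gap.\<close>

lemma delta_elem_bounds:
  assumes "d \<in> delta_elem p n m" and dvd: "\<And>i. i \<in> {1..p} \<Longrightarrow> g dvd b i - a i"
  shows "0 < d" and "g dvd d" and "\<exists>i\<in>{1..p}. d \<le> b i - a i"
proof -
  obtain s where s: "d > 0" "s \<in> length_set p n m" "s + d \<in> length_set p n m"
    "\<forall>t\<in>length_set p n m. t \<le> s \<or> s + d \<le> t"
    using assms(1) in_delta_elem_iff by auto
  then show "0 < d" "g dvd d"
    using dvd_length_diff[OF dvd s(2,3)] by auto
  show "\<exists>i\<in>{1..p}. d \<le> b i - a i"
    using s(2)
  proof (cases rule: trade_or_longest)
    case (1 i)
    then show ?thesis
      using s(4) a_less_b[of i] by force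
  next
    case 2
    then show ?thesis
      using s by force
  qed
qed

section \<open>Realising gaps\<close>

text \<open>Coprimality forbids mixing. Generators below \<open>i\<close> contribute a multiple
  \<open>U\<close> of \<open>A\<close>, the others a multiple \<open>V\<close> of \<open>B\<close>.
  Since \<open>A\<close> and \<open>B\<close> are coprime and \<open>U + V = A * B\<close>, also
  \<open>A * B\<close> divides \<open>V\<close>, so \<open>V\<close> or \<open>U\<close>
  vanishes.\<close>

lemma length_trade_element:
  assumes i: "i \<in> {1..p}" and t: "t \<in> length_set p n (a i * n i)"
  shows "t \<le> a i \<or> b i \<le> t"
proof -
  obtain x where x: "(\<Sum>j\<in>{0..p}. x j * n j) = a i * n i" "t = (\<Sum>j\<in>{0..p}. x j)"
    using t by (auto simp: length_set_def factorizations_def factorization_hom_def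
        factorization_length_def)
  define A where "A = (\<Prod>j\<in>{i..p}. a j)"
  define B where "B = (\<Prod>j\<in>{1..i}. b j)"
  define U where "U = (\<Sum>j\<in>{..<i}. x j * n j)"
  define V where "V = (\<Sum>j\<in>{i..p}. x j * n j)"
  have split: "sum f {0..p} = sum f {..<i} + sum f {i..p}" for f :: "nat \<Rightarrow> nat"
  proof -
    have "{0..p} = {..<i} \<union> {i..p}"
      using i by auto
    then show ?thesis
      by (simp add: sum.union_disjoint disjoint_iff)
  qed
  have UV: "U + V = a i * n i"
    using x(1) split by (simp add: U_def V_def)
  have AB: "a i * n i = A * B"
    using i by (simp add: A_def B_def compound_seq_def prod.atLeast_Suc_atMost)
  have pos: "0 < a i" "0 < n i" "0 < n (i - 1)"
    using a_ge_2[OF i] n_pos[of i] n_pos[of "i - 1"] i by force+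
  have "A dvd U"
    unfolding A_def U_def by (intro dvd_sum dvd_mult prod_a_dvd_n) auto
  then have "A dvd V"
    using UV AB by (metis dvd_add_right_iff dvd_triv_left)
  moreover have "B dvd V"
    unfolding B_def V_def by (intro dvd_sum dvd_mult prod_b_dvd_n) auto
  moreover have "coprime A B"
    unfolding A_def B_def by (intro prod_coprime_left coprime_a_prod_b) (use i in auto)
  ultimately have "a i * n i dvd V"
    unfolding AB by (simp add: divides_mult)
  then consider "V = 0" | "U = 0"
    using UV dvd_imp_le[of "a i * n i" V] by force
  then show ?thesis
  proof cases
    case 1
    have zero: "x j = 0" if "j \<in> {i..p}" for j
      using 1 that n_pos[of j] by (force simp: V_def)
    \<comment> \<open>Every generator in use is at most \<open>n (i - 1)\<close>, so the value
      \<open>n (i - 1) * b i\<close> takes at least \<open>b i\<close> of them.\<close>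
    have "n (i - 1) * b i = U"
      using UV 1 n_trade[OF i] by (simp add: mult.commute)
    also have "\<dots> \<le> (\<Sum>j\<in>{..<i}. x j * n (i - 1))"
      unfolding U_def by (intro sum_mono mult_left_mono n_mono) (use i in auto)
    also have "\<dots> = n (i - 1) * t"
      using x(2) split[of x] zero by (simp add: sum_distrib_right[symmetric] mult.commute)
    finally show ?thesis
      using pos by simp
  next
    case 2
    have zero: "x j = 0" if "j < i" for j
      using 2 that n_pos[of j] i by (force simp: U_def)
    \<comment> \<open>Every generator in use is at least \<open>n i\<close>, so the value
      \<open>n i * a i\<close> admits at most \<open>a i\<close> of them.\<close>
    have "n i * t = (\<Sum>j\<in>{i..p}. x j * n i)"
      using x(2) split[of x] zero by (simp add: sum_distrib_right[symmetric] mult.commute)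
    also have "\<dots> \<le> V"
      unfolding V_def by (intro sum_mono mult_left_mono n_mono) auto
    also have "\<dots> = n i * a i"
      using UV 2 by simp
    finally show ?thesis
      using pos by simp
  qed
qed

lemma lengths_trade_element:
  assumes "i \<in> {1..p}"
  shows "a i \<in> length_set p n (a i * n i)" and "b i \<in> length_set p n (a i * n i)"
proof -
  show "a i \<in> length_set p n (a i * n i)"
    by (rule length_set_multiple) (use assms in auto)
  have "b i \<in> length_set p n (b i * n (i - 1))"
    by (rule length_set_multiple) (use assms in auto)
  then show "b i \<in> length_set p n (a i * n i)"
    using n_trade[OF assms] by (simp add: mult.commute)
qed

lemma diff_in_delta_elem:
  assumes "i \<in> {1..p}"
  shows "b i - a i \<in> delta_elem p n (a i * n i)"
proof -
  have eq: "a i + (b i - a i) = b i"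
    using a_less_b[OF assms] by simp
  show ?thesis
    unfolding in_delta_elem_iff
  proof (intro conjI bexI[of _ "a i"] ballI)
    show "0 < b i - a i"
      using a_less_b[OF assms] by simp
  qed (simp_all only: eq lengths_trade_element[OF assms] length_trade_element[OF assms])
qed

text \<open>Trading in only one of the two summands gives the lengths \<open>b i + a j\<close> and
  \<open>a i + b j\<close>, which are \<open>g\<close> apart. No length lies between them, as all
  lengths are congruent modulo \<open>g\<close>.\<close>

lemma gcd_in_delta_elem:
  assumes dvd: "\<And>k. k \<in> {1..p} \<Longrightarrow> g dvd b k - a k" and "g > 0"
    and i: "i \<in> {1..p}" and j: "j \<in> {1..p}" and eq: "b j - a j = (b i - a i) + g"
  shows "g \<in> delta_elem p n (a i * n i + a j * n j)"
proof -
  let ?L = "length_set p n (a i * n i + a j * n j)"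
  have s: "b i + a j \<in> ?L"
    using lengths_trade_element i j by (intro length_set_add)
  have "a i + b j \<in> ?L"
    using lengths_trade_element i j by (intro length_set_add)
  moreover have "a i + b j = b i + a j + g"
    using eq a_less_b[OF i] a_less_b[OF j] by simp
  ultimately have "b i + a j + g \<in> ?L"
    by simp
  moreover have "t \<le> b i + a j \<or> b i + a j + g \<le> t" if "t \<in> ?L" for t
    using dvd_length_diff[OF dvd s that] dvd_imp_le[of g "t - (b i + a j)"] by force
  ultimately show ?thesis
    unfolding in_delta_elem_iff using s \<open>g > 0\<close> by blast
qed

end

section \<open>Delta set of the semigroup\<close>

lemma generator_in_submonoid_generated: "g \<in> G \<Longrightarrow> g \<in> submonoid_generated G"
  using submonoid_generated.add[OF _ submonoid_generated.zero] by fastforce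

lemma numerical_semigroup_multiple:
  assumes "numerical_semigroup S" and "x \<in> S"
  shows "c * x \<in> S"
  by (induction c) (use assms in \<open>auto simp: numerical_semigroup_def\<close>)

theorem corollary20:
  fixes p :: nat and a b :: "nat \<Rightarrow> nat" and S N :: "nat set"
  assumes "NSCS p a b S"
    and "N = (\<lambda>i. b i - a i) ` {1..p}"
  shows "(card N = 1 \<longrightarrow> delta_set p (compound_seq p a b) S = N) \<and>
    (card N > 1 \<and> (\<exists>\<alpha>::nat. \<alpha> \<ge> 1 \<and> N = (\<lambda>k. k * \<alpha>) ` {1..card N}) \<longrightarrow>
       delta_set p (compound_seq p a b) S = N) \<and>
    (\<forall>\<alpha>::nat. \<alpha> \<ge> 1 \<and> card N > 1 \<and> N = (\<lambda>k. k * \<alpha>) ` {2..card N + 1} \<longrightarrow>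
       delta_set p (compound_seq p a b) S = N \<union> {\<alpha>})"
proof -
  interpret compound p a b
    using assms(1) by unfold_locales (simp add: NSCS_def)
  have semigroup: "numerical_semigroup S" and gen: "submonoid_generated (n ` {0..p}) = S"
    using assms(1) by (auto simp: NSCS_def minimal_generating_set_def)
  have mult_mem: "c * n i \<in> S" if "i \<in> {1..p}" for c i
    using numerical_semigroup_multiple[OF semigroup] generator_in_submonoid_generated gen that
    by auto
  have N_subset: "N \<subseteq> delta_set p n S"
    unfolding assms(2) delta_set_def
    by (rule image_subsetI, rule UN_I, rule mult_mem, assumption, rule diff_in_delta_elem)
  have bounds: "0 < d \<and> g dvd d \<and> (\<exists>e\<in>N. d \<le> e)"
    if d: "d \<in> delta_set p n S" and dvd: "\<forall>e\<in>N. g dvd e" for d g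
  proof -
    obtain m where "d \<in> delta_elem p n m"
      using d by (auto simp: delta_set_def)
    then show ?thesis
      using delta_elem_bounds[of d m g] dvd by (auto simp: assms(2))
  qed
  \<comment> \<open>The upper inclusion of all three cases, with \<open>K\<close> equal to 1,
    \<open>card N\<close> and \<open>card N + 1\<close> respectively.\<close>
  have multiple: "\<exists>k\<in>{1..K}. d = k * \<alpha>"
    if "d \<in> delta_set p n S" and N: "N \<subseteq> (\<lambda>k. k * \<alpha>) ` {1..K}" for d \<alpha> K
  proof -
    have "\<forall>e\<in>N. \<alpha> dvd e"
      using N by auto
    then have d: "0 < d" "\<alpha> dvd d" "\<exists>e\<in>N. d \<le> e"
      using bounds[OF that(1), of \<alpha>] by blast+
    then obtain k where k: "d = k * \<alpha>"
      by (metis dvd_def mult.commute)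
    obtain k' where "d \<le> k' * \<alpha>" "k' \<le> K"
      using d(3) N by force
    then have "k \<le> K"
      using k d(1) by simp
    then show ?thesis
      using k d(1) by (auto simp: Suc_le_eq)
  qed
  show ?thesis
  proof (intro conjI impI allI)
    assume "card N = 1"
    then obtain \<alpha> where N: "N = {\<alpha>}"
      by (auto simp: card_1_singleton_iff)
    have "delta_set p n S \<subseteq> N"
      using multiple[of _ \<alpha> 1] N by auto
    then show "delta_set p n S = N"
      using N_subset by auto
  next
    assume "card N > 1 \<and> (\<exists>\<alpha>::nat. \<alpha> \<ge> 1 \<and> N = (\<lambda>k. k * \<alpha>) ` {1..card N})"
    then obtain \<alpha> where N: "N = (\<lambda>k. k * \<alpha>) ` {1..card N}"
      by blast
    have "delta_set p n S \<subseteq> N"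
      using multiple[of _ \<alpha> "card N"] N by blast
    then show "delta_set p n S = N"
      using N_subset by auto
  next
    fix \<alpha> :: nat
    assume "\<alpha> \<ge> 1 \<and> card N > 1 \<and> N = (\<lambda>k. k * \<alpha>) ` {2..card N + 1}"
    then have \<alpha>: "\<alpha> \<ge> 1" and card: "card N > 1" and N: "N = (\<lambda>k. k * \<alpha>) ` {2..card N + 1}"
      by auto
    have "N \<subseteq> (\<lambda>k. k * \<alpha>) ` {1..card N + 1}"
      by (subst N) auto
    \<comment> \<open>The multiples allowed by the bound exceed \<open>N\<close> only by
      \<open>1 * \<alpha>\<close>.\<close>
    moreover have "{1..card N + 1} = insert 1 {2..card N + 1}"
      by auto
    ultimately have "delta_set p n S \<subseteq> N \<union> {\<alpha>}"
      using multiple[of _ \<alpha> "card N + 1"] N by force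
    moreover have "\<alpha> \<in> delta_set p n S"
    proof -
      \<comment> \<open>\<open>card N > 1\<close> puts 3 into
        \<open>{2..card N + 1}\<close>.\<close>
      have "2 * \<alpha> \<in> N" "3 * \<alpha> \<in> N"
        using card by (subst N, force)+
      then obtain i j where ij: "i \<in> {1..p}" "j \<in> {1..p}" "b i - a i = 2 * \<alpha>" "b j - a j = 3 * \<alpha>"
        unfolding assms(2) by (metis (no_types, lifting) imageE)
      have "\<alpha> dvd e" if "e \<in> N" for e
        using that by (subst (asm) N) auto
      then have "\<alpha> \<in> delta_elem p n (a i * n i + a j * n j)"
        using ij \<alpha> by (intro gcd_in_delta_elem) (auto simp: assms(2))
      moreover have "a i * n i + a j * n j \<in> S"
        using mult_mem ij semigroup by (simp add: numerical_semigroup_def)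
      ultimately show ?thesis
        by (auto simp: delta_set_def)
    qed
    ultimately show "delta_set p n S = N \<union> {\<alpha>}"
      using N_subset by auto
  qed
qed

end
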